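(* For every $k\ge 2$, any asymptotically exact streaming algorithm for estimating $F_k$ under insertions and deletions requires $\Omega(n)$ memory.
   Context: The input is a stream of updates, each inserting or deleting one copy of an integer from $[N]$; after a prefix of length $n$, $m_i$ is the current multiplicity of $i$ and $F_k=\sum_{i=1}^N m_i^k$. An asymptotically exact streaming algorithm for $F_k$ here means a one-pass streaming algorithm that, on an infinite update stream, after every prefix of length $n$ maintains an estimate $\tilde F_k$ with, with probability at least $1-\delta$ ($\delta<1/2$), $\tilde F_k/F_k\to1$ as $n\to\infty$; the claim is that any such algorithm uses $\Omega(n)$ bits of memory in the worst case.
   Formalization: The universe size N is taken to depend on the stream length n with N(n) = Ω(n), and the algorithm may depend on N; for fixed N, or N not Ω(n), the claim fails because exact counters use o(n) bits. *)

theory Defs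
  imports "HOL-Probability.Probability" "HOL-Library.Landau_Symbols"
begin

datatype update = Insert nat | Delete nat

primrec item :: "update \<Rightarrow> nat" where
  "item (Insert i) = i"
| "item (Delete i) = i"

text \<open>An infinite stream is a function \<open>us\<close>; its prefix of length \<open>n\<close> is
  \<open>us 0, \<dots>, us (n - 1)\<close>.\<close>

definition multiplicity_after :: "(nat \<Rightarrow> update) \<Rightarrow> nat \<Rightarrow> nat \<Rightarrow> int" where
  "multiplicity_after us n i =
     int (card {t. t < n \<and> us t = Insert i}) - int (card {t. t < n \<and> us t = Delete i})"

text \<open>Only a copy that is present can be deleted, so multiplicities never become negative.\<close>

definition update_stream :: "nat \<Rightarrow> (nat \<Rightarrow> update) \<Rightarrow> bool" where
  "update_stream N us \<longleftrightarrow>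
     (\<forall>t. item (us t) \<in> {1..N}) \<and> (\<forall>n i. 0 \<le> multiplicity_after us n i)"

definition frequency_moment :: "nat \<Rightarrow> nat \<Rightarrow> (nat \<Rightarrow> update) \<Rightarrow> nat \<Rightarrow> real" where
  "frequency_moment k N us n = (\<Sum>i=1..N. real_of_int (multiplicity_after us n i) ^ k)"

text \<open>A randomized one-pass algorithm whose memory is a bit string. The randomness is one
  outcome \<open>\<omega>\<close> of an arbitrary probability space, and the number of updates processed so far is
  passed to \<open>step\<close> and \<open>answer\<close>; neither is charged as memory. An algorithm that tosses fresh
  coins at every update is the instance where \<open>coins\<close> is a product over the update times and
  \<open>step\<close> at time \<open>t\<close> reads only the component of \<open>\<omega>\<close> belonging to \<open>t\<close>.\<close>

record 'w streaming_alg =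
  coins :: "'w measure"
  init :: "'w \<Rightarrow> bool list"
  step :: "'w \<Rightarrow> nat \<Rightarrow> update \<Rightarrow> bool list \<Rightarrow> bool list"
  answer :: "'w \<Rightarrow> nat \<Rightarrow> bool list \<Rightarrow> real"

primrec memory_after :: "'w streaming_alg \<Rightarrow> (nat \<Rightarrow> update) \<Rightarrow> 'w \<Rightarrow> nat \<Rightarrow> bool list" where
  "memory_after A us \<omega> 0 = init A \<omega>"
| "memory_after A us \<omega> (Suc n) = step A \<omega> n (us n) (memory_after A us \<omega> n)"

definition estimate :: "'w streaming_alg \<Rightarrow> (nat \<Rightarrow> update) \<Rightarrow> 'w \<Rightarrow> nat \<Rightarrow> real" where
  "estimate A us \<omega> n = answer A \<omega> n (memory_after A us \<omega> n)"

text \<open>The ratio of estimate and moment is undefined when the moment is \<open>0\<close> (the current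
  multiset is empty), so convergence is only demanded on streams whose moment is eventually
  positive; with \<open>x / 0 = 0\<close> no algorithm could satisfy it on the others. A non-measurable
  event has \<open>measure\<close> \<open>0\<close>, so for \<open>\<delta> < 1\<close> the bound includes measurability of the event.\<close>

definition asymptotically_exact ::
  "nat \<Rightarrow> real \<Rightarrow> nat \<Rightarrow> 'w streaming_alg \<Rightarrow> bool" where
  "asymptotically_exact k \<delta> N A \<longleftrightarrow>
     prob_space (coins A) \<and>
     (\<forall>us. update_stream N us \<and> (\<forall>\<^sub>F n in sequentially. frequency_moment k N us n > 0) \<longrightarrow>
        \<P>(\<omega> in coins A.
            (\<lambda>n. estimate A us \<omega> n / frequency_moment k N us n) \<longlonglongrightarrow> 1) \<ge> 1 - \<delta>)"

definition worst_case_memory :: "nat \<Rightarrow> 'w streaming_alg \<Rightarrow> nat \<Rightarrow> enat" where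
  "worst_case_memory N A n =
     (SUP (us, \<omega>) \<in> {us. update_stream N us} \<times> space (coins A).
        enat (length (memory_after A us \<omega> n)))"

end

theory Submission
  imports Defs "HOL-Real_Asymp.Real_Asymp"
begin

text \<open>
  The proof reduces from the one-way communication problem INDEX. A set \<open>S \<subseteq> {..<m}\<close> is
  encoded in a prefix of \<open>n\<close> insertions, and membership \<open>j \<in> S\<close> is queried by inserting and
  deleting item \<open>j + 1\<close> forever: the moment then oscillates between two constants whose
  difference is \<open>2 ^ k - 1\<close> if \<open>j \<in> S\<close> and \<open>1\<close> otherwise, and an asymptotically exact algorithm
  reveals this difference. Hence the memory content at time \<open>n\<close> determines each bit of \<open>S\<close> with
  probability at least \<open>1 - \<delta>\<close>. Averaging over \<open>S\<close> and \<open>j\<close> fixes the randomness, and an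
  exponential-moment bound shows that the remaining deterministic code needs
  \<open>exp ((1 - 2 * \<delta>)\<^sup>2 * m / 2)\<close> memory contents.
\<close>

section \<open>Decoding random sets from few codewords\<close>

text \<open>\<open>cosh x\<close> is the moment generating function of a uniform random sign, so
  this is Hoeffding's lemma for the simplest centred variable.\<close>

lemma cosh_le_exp_square:
  fixes x :: real
  assumes "0 \<le> x"
  shows "cosh x \<le> exp (x\<^sup>2 / 2)"
proof -
  \<comment> \<open>A fair Bernoulli variable stretched to width \<open>2 * x\<close>; the later
    factor \<open>exp (- x)\<close> recentres it and gives \<open>cosh x\<close>.\<close>
  have "- (2 * x) * (1 / 2) + ln (1 + 1 / 2 * (exp (2 * x) - 1)) \<le> (2 * x)\<^sup>2 / 8"
    using assms by (intro Hoeffdings_lemma_aux) auto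
  then have "ln (1 + 1 / 2 * (exp (2 * x) - 1)) \<le> x + x\<^sup>2 / 2"
    by (simp add: power2_eq_square)
  moreover have pos: "1 + 1 / 2 * (exp (2 * x) - 1) > 0"
    by (simp add: field_simps add_pos_pos)
  ultimately have "1 + 1 / 2 * (exp (2 * x) - 1) \<le> exp (x + x\<^sup>2 / 2)"
    by (metis exp_le_cancel_iff exp_ln)
  then have "exp (- x) * (1 + 1 / 2 * (exp (2 * x) - 1)) \<le> exp (- x) * exp (x + x\<^sup>2 / 2)"
    by (intro mult_left_mono) auto
  moreover have "exp (- x) * (1 + 1 / 2 * (exp (2 * x) - 1)) = cosh x"
    by (simp add: cosh_field_def algebra_simps flip: exp_add)
  ultimately show ?thesis
    by (simp flip: exp_add)
qed

definition agreement :: "'a set \<Rightarrow> 'a set \<Rightarrow> 'a set \<Rightarrow> 'a set" where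
  "agreement J S T = {j \<in> J. j \<in> S \<longleftrightarrow> j \<in> T}"

text \<open>The exponent is \<open>l\<close> times a sum of signs over \<open>J\<close>, positive
  where \<open>S\<close> and \<open>T\<close> agree. Hence the sum over \<open>S\<close> factors
  over \<open>J\<close>, and every factor is \<open>exp l + exp (- l)\<close> whatever
  \<open>T\<close> is.\<close>

lemma sum_exp_agreement:
  fixes l :: real
  assumes "finite J"
  shows "(\<Sum>S\<in>Pow J. exp (l * (2 * real (card (agreement J S T)) - real (card J))))
           = (2 * cosh l) ^ card J"
proof -
  \<comment> \<open>\<open>g1 j\<close> and \<open>g2 j\<close> are the contributions of
    \<open>j\<close> when \<open>j \<in> S\<close> and when \<open>j \<notin> S\<close>; expanding
    the product of all \<open>g1 j + g2 j\<close> gives the sum over subsets.\<close>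
  define g1 where "g1 j = exp (if j \<in> T then l else - l)" for j
  define g2 where "g2 j = exp (if j \<in> T then - l else l)" for j
  have "(\<Prod>x\<in>S. g1 x) * (\<Prod>x\<in>J - S. g2 x)
          = exp (l * (2 * real (card (agreement J S T)) - real (card J)))" if "S \<subseteq> J" for S
  proof -
    have fS: "finite S" "finite (J - S)"
      using assms that finite_subset by auto
    have "(\<Prod>x\<in>S. g1 x) * (\<Prod>x\<in>J - S. g2 x)
        = (\<Prod>x\<in>S. exp (if x \<in> S \<longleftrightarrow> x \<in> T then l else - l))
          * (\<Prod>x\<in>J - S. exp (if x \<in> S \<longleftrightarrow> x \<in> T then l else - l))"
      unfolding g1_def g2_def
      by (intro arg_cong2[where f = "(*)"] prod.cong) auto
    also have "\<dots> = (\<Prod>x\<in>J. exp (if x \<in> S \<longleftrightarrow> x \<in> T then l else - l))"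
      by (simp only: prod.subset_diff[OF that assms] mult.commute)
    also have "\<dots> = exp (\<Sum>x\<in>J. (if x \<in> S \<longleftrightarrow> x \<in> T then l else - l))"
      using assms by (simp add: exp_sum)
    also have "(\<Sum>x\<in>J. (if x \<in> S \<longleftrightarrow> x \<in> T then l else - l))
        = (\<Sum>x\<in>J. 2 * l * of_bool (x \<in> S \<longleftrightarrow> x \<in> T) - l)"
      by (intro sum.cong) auto
    also have "\<dots> = l * (2 * real (card (agreement J S T)) - real (card J))"
      using assms
      by (simp add: sum_subtractf agreement_def Int_def algebra_simps flip: sum_distrib_left)
    finally show ?thesis .
  qed
  then have "(\<Sum>S\<in>Pow J. exp (l * (2 * real (card (agreement J S T)) - real (card J))))
      = (\<Prod>x\<in>J. g1 x + g2 x)"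
    using assms by (simp add: prod_add)
  also have "\<dots> = (\<Prod>x\<in>J. 2 * cosh l)"
    by (intro prod.cong) (auto simp: g1_def g2_def cosh_field_def)
  finally show ?thesis
    by simp
qed

text \<open>Let \<open>l = 2 * p - 1\<close> and \<open>m = card J\<close>. For a fixed decoded set
  the average over \<open>S\<close> of the exponential of \<open>l\<close> times the sign sum is at
  most \<open>exp (l\<^sup>2 * m / 2)\<close>. Correctness pushes it to
  \<open>exp (l\<^sup>2 * m)\<close> for the set actually decoded, and only a large \<open>Q\<close>
  can make up the difference.\<close>

lemma random_access_code_bound:
  fixes enc :: "'a set \<Rightarrow> 'q" and dec :: "'q \<Rightarrow> 'a set" and p :: real
  assumes J: "finite J" and Q: "finite Q" and enc: "enc ` Pow J \<subseteq> Q" and p: "p \<ge> 1 / 2"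
    and correct: "p * real (card J) * 2 ^ card J
                    \<le> (\<Sum>S\<in>Pow J. real (card (agreement J S (dec (enc S)))))"
  shows "exp ((2 * p - 1)\<^sup>2 * real (card J) / 2) \<le> real (card Q)"
proof -
  define m where "m = real (card J)"
  \<comment> \<open>Among all tilts \<open>t\<close>, this one maximises
    \<open>t * (2 * p - 1) - t\<^sup>2 / 2\<close>, the exponent gained per element of
    \<open>J\<close>.\<close>
  define l where "l = 2 * p - 1"
  define a where "a = l\<^sup>2 * m"
  define x where "x S T = l * (2 * real (card (agreement J S T)) - m)" for S T
  have l: "l \<ge> 0"
    using p by (simp add: l_def)
  have card_Pow_J: "card (Pow J) = 2 ^ card J"
    using J by (simp add: card_Pow)
  have mean: "a * 2 ^ card J \<le> (\<Sum>S\<in>Pow J. x S (dec (enc S)))"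
  proof -
    have "a * 2 ^ card J = l * (2 * (p * m * 2 ^ card J) - m * 2 ^ card J)"
      by (simp add: a_def l_def power2_eq_square algebra_simps)
    also have "\<dots> \<le> l * (2 * (\<Sum>S\<in>Pow J. real (card (agreement J S (dec (enc S)))))
                          - m * 2 ^ card J)"
      using correct l by (intro mult_left_mono) (auto simp: m_def)
    also have "\<dots> = (\<Sum>S\<in>Pow J. x S (dec (enc S)))"
      by (simp add: x_def sum_subtractf card_Pow_J flip: sum_distrib_left)
    finally show ?thesis .
  qed
  \<comment> \<open>Jensen's inequality for \<open>exp\<close>, via its tangent at \<open>a\<close>\<close>
  have "exp a * 2 ^ card J
      \<le> exp a * (2 ^ card J + (\<Sum>S\<in>Pow J. x S (dec (enc S))) - a * 2 ^ card J)"
    using mean by simp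
  also have "\<dots> = (\<Sum>S\<in>Pow J. exp a * (1 + (x S (dec (enc S)) - a)))"
    by (simp add: sum.distrib sum_subtractf card_Pow_J flip: sum_distrib_left)
  also have "\<dots> \<le> (\<Sum>S\<in>Pow J. exp a * exp (x S (dec (enc S)) - a))"
    by (intro sum_mono mult_left_mono exp_ge_add_one_self) auto
  also have "\<dots> = (\<Sum>S\<in>Pow J. exp (x S (dec (enc S))))"
    by (simp flip: exp_add)
  \<comment> \<open>Union bound: the codeword of \<open>S\<close> is one of those in
    \<open>Q\<close>. From here on the encoder no longer occurs.\<close>
  also have "\<dots> \<le> (\<Sum>S\<in>Pow J. \<Sum>q\<in>Q. exp (x S (dec q)))"
    using enc Q by (intro sum_mono member_le_sum) auto
  also have "\<dots> = (\<Sum>q\<in>Q. \<Sum>S\<in>Pow J. exp (x S (dec q)))"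
    by (rule sum.swap)
  also have "\<dots> = real (card Q) * (2 * cosh l) ^ card J"
    using sum_exp_agreement[OF J] by (simp add: x_def m_def)
  also have "\<dots> \<le> real (card Q) * (2 * exp (l\<^sup>2 / 2)) ^ card J"
    using cosh_le_exp_square[OF l] by (intro mult_left_mono power_mono) auto
  also have "\<dots> = real (card Q) * exp (a / 2) * 2 ^ card J"
    by (simp add: power_mult_distrib a_def m_def mult_ac flip: exp_of_nat_mult)
  finally have "exp (a / 2) * exp (a / 2) \<le> real (card Q) * exp (a / 2)"
    by (simp flip: exp_add)
  then show ?thesis
    by (simp add: a_def l_def m_def)
qed

text \<open>By linearity the expected number of events that occur is at least
  \<open>p * card I\<close>, so some outcome attains this value. It serves to fix the coins of the
  algorithm.\<close>

lemma (in prob_space) average_event_count: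
  fixes E :: "'b \<Rightarrow> 'a set" and p :: real
  assumes "finite I" and "\<And>i. i \<in> I \<Longrightarrow> E i \<in> events" and "\<And>i. i \<in> I \<Longrightarrow> p \<le> prob (E i)"
  obtains \<omega> where "\<omega> \<in> space M" and "p * real (card I) \<le> real (card {i \<in> I. \<omega> \<in> E i})"
proof -
  define X where "X \<omega> = (\<Sum>i\<in>I. indicator (E i) \<omega> :: real)" for \<omega>
  have X_card: "X \<omega> = real (card {i \<in> I. \<omega> \<in> E i})" for \<omega>
    using assms(1) by (simp add: X_def indicator_def Int_def)
  have int: "integrable M X"
    unfolding X_def using assms(2)
    by (intro Bochner_Integration.integrable_sum integrable_real_indicator)
       (auto simp: emeasure_eq_measure)
  have "p * real (card I) = (\<Sum>i\<in>I. p)"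
    by simp
  also have "\<dots> \<le> (\<Sum>i\<in>I. prob (E i))"
    using assms(3) by (intro sum_mono)
  also have "\<dots> = expectation X"
    unfolding X_def using assms(2)
    by (subst Bochner_Integration.integral_sum) (auto simp: emeasure_eq_measure)
  finally have "\<not> expectation X < p * real (card I)"
    by simp
  then have "\<not> (AE \<omega> in M. X \<omega> < p * real (card I))"
    using expectation_less[OF int] by blast
  then have "\<exists>\<omega>\<in>space M. \<not> X \<omega> < p * real (card I)"
    by (meson AE_I2)
  then show thesis
    using that by (auto simp: X_card not_less)
qed

lemma card_bool_lists_length_le: "card {xs :: bool list. length xs \<le> L} \<le> 2 ^ Suc L"
proof -
  have "card {xs :: bool list. length xs \<le> L} = (\<Sum>i\<le>L. 2 ^ i)"
    using card_lists_length_le[of "UNIV :: bool set" L] by simp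
  also have "\<dots> = 2 ^ Suc L - 1"
    by (induction L) auto
  finally show ?thesis
    by simp
qed

section \<open>Hard streams\<close>

lemma multiplicity_after_0 [simp]: "multiplicity_after us 0 i = 0"
  by (simp add: multiplicity_after_def)

lemma multiplicity_after_Suc:
  "multiplicity_after us (Suc n) i =
     multiplicity_after us n i + of_bool (us n = Insert i) - of_bool (us n = Delete i)"
proof -
  have *: "{t. t < Suc n \<and> us t = u}
      = (if us n = u then insert n {t. t < n \<and> us t = u} else {t. t < n \<and> us t = u})" for u
    by (auto simp: less_Suc_eq)
  show ?thesis
    unfolding multiplicity_after_def * by simp
qed

lemma memory_after_cong:
  assumes "\<And>t. t < n \<Longrightarrow> us t = us' t"
  shows "memory_after A us \<omega> n = memory_after A us' \<omega> n"
  using assms by (induction n) auto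

text \<open>Past updates act on the rest of the run only through the memory, which thus plays the
  role of the one-way message.\<close>

lemma memory_after_resume:
  assumes "memory_after A us \<omega> n = memory_after A us' \<omega> n" and "\<And>t. n \<le> t \<Longrightarrow> us t = us' t"
  shows "memory_after A us \<omega> (n + r) = memory_after A us' \<omega> (n + r)"
  using assms by (induction r) auto

text \<open>Elements outside \<open>S\<close> are replaced by the padding item \<open>m + 1\<close>, so that the prefix always
  has length \<open>n\<close>.\<close>

definition index_stream :: "nat \<Rightarrow> nat \<Rightarrow> nat set \<Rightarrow> nat \<Rightarrow> nat \<Rightarrow> update" where
  "index_stream n m S j t =
     (if t < n then Insert (if t \<in> S then Suc t else Suc m)
      else if even (t - n) then Insert (Suc j) else Delete (Suc j))"

lemma multiplicity_index_stream_even: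
  "multiplicity_after (index_stream n m S j) (n + 2 * r) i =
     multiplicity_after (index_stream n m S j) n i"
  by (induction r) (auto simp: multiplicity_after_Suc index_stream_def)

lemma multiplicity_index_stream_odd:
  "multiplicity_after (index_stream n m S j) (Suc (n + 2 * r)) i =
     multiplicity_after (index_stream n m S j) n i + of_bool (i = Suc j)"
  unfolding multiplicity_after_Suc multiplicity_index_stream_even
  by (auto simp: index_stream_def)

text \<open>Within the prefix, item \<open>Suc j'\<close> can be inserted only at time
  \<open>j'\<close>, and the padding item \<open>Suc m\<close> is a different one.\<close>

lemma multiplicity_index_stream_prefix:
  assumes "t \<le> n" and "S \<subseteq> {..<m}" and "j' < m"
  shows "multiplicity_after (index_stream n m S j) t (Suc j') = of_bool (j' \<in> S \<and> j' < t)"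
  using assms(1)
proof (induction t)
  case (Suc t)
  then show ?case
    using assms(2,3) by (auto simp: multiplicity_after_Suc index_stream_def less_Suc_eq)
qed simp

lemma multiplicity_index_stream_prefix_nonneg:
  "t \<le> n \<Longrightarrow> 0 \<le> multiplicity_after (index_stream n m S j) t i"
  by (induction t) (auto simp: multiplicity_after_Suc index_stream_def)

lemma index_stream_time_cases:
  fixes n t :: nat
  obtains "t < n" | r where "t = n + 2 * r" | r where "t = Suc (n + 2 * r)"
proof (cases "t < n")
  case False
  then have "t = n + 2 * ((t - n) div 2) \<or> t = Suc (n + 2 * ((t - n) div 2))"
    by presburger
  then show thesis
    using that by blast
qed (use that in blast)

text \<open>Each deletion directly follows an insertion of the same item, and \<open>m < N\<close>
  leaves room for the padding item.\<close>

lemma update_stream_index_stream: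
  assumes "S \<subseteq> {..<m}" and "j < N" and "m < N"
  shows "update_stream N (index_stream n m S j)"
  unfolding update_stream_def
proof (intro conjI allI)
  show "item (index_stream n m S j t) \<in> {1..N}" for t
    using assms by (auto simp: index_stream_def)
  show "0 \<le> multiplicity_after (index_stream n m S j) t i" for t i
    by (cases rule: index_stream_time_cases[of t n])
       (auto simp: multiplicity_index_stream_even multiplicity_index_stream_odd
         multiplicity_index_stream_prefix_nonneg)
qed

lemma frequency_moment_index_stream_even:
  "frequency_moment k N (index_stream n m S j) (n + 2 * r)
     = frequency_moment k N (index_stream n m S j) n"
  by (simp add: frequency_moment_def multiplicity_index_stream_even)

text \<open>Only item \<open>Suc j\<close> changes, from multiplicity 0 to 1 or from 1 to 2, so the
  increment is \<open>1 ^ k - 0 ^ k\<close> or \<open>2 ^ k - 1 ^ k\<close>.\<close>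

lemma frequency_moment_index_stream_odd:
  assumes "S \<subseteq> {..<m}" and "j < m" and "m < N" and "m \<le> n" and "k > 0"
  shows "frequency_moment k N (index_stream n m S j) (Suc (n + 2 * r))
     = frequency_moment k N (index_stream n m S j) n + (if j \<in> S then 2 ^ k - 1 else 1)"
proof -
  let ?M = "multiplicity_after (index_stream n m S j) n"
  have j: "Suc j \<in> {1..N}"
    using assms by auto
  have Mj: "?M (Suc j) = of_bool (j \<in> S)"
    using multiplicity_index_stream_prefix[of n n S m j j] assms by auto
  have "(\<Sum>i=1..N. real_of_int (?M i + of_bool (i = Suc j)) ^ k)
      = real_of_int (?M (Suc j) + 1) ^ k
        + (\<Sum>i\<in>{1..N} - {Suc j}. real_of_int (?M i + of_bool (i = Suc j)) ^ k)"
    using j by (subst sum.remove[of "{1..N}" "Suc j"]) auto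
  also have "(\<Sum>i\<in>{1..N} - {Suc j}. real_of_int (?M i + of_bool (i = Suc j)) ^ k)
      = (\<Sum>i\<in>{1..N} - {Suc j}. real_of_int (?M i) ^ k)"
    by (intro sum.cong) auto
  also have "\<dots> = (\<Sum>i=1..N. real_of_int (?M i) ^ k) - real_of_int (?M (Suc j)) ^ k"
    using j by (subst sum.remove[of "{1..N}" "Suc j"]) auto
  finally show ?thesis
    using assms(5) by (simp add: frequency_moment_def multiplicity_index_stream_odd Mj)
qed

text \<open>The prefix contains no deletions, so the item inserted at time 0 is still present at
  time \<open>n\<close>.\<close>

lemma frequency_moment_index_stream_pos:
  assumes "S \<subseteq> {..<m}" and "m < N" and "0 < n"
  shows "0 < frequency_moment k N (index_stream n m S j) n"
proof -
  let ?us = "index_stream n m S j"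
  obtain i where i: "?us 0 = Insert i" "i \<in> {1..N}"
    using assms by (auto simp: index_stream_def)
  have nonneg: "0 \<le> multiplicity_after ?us n i'" for i'
    by (rule multiplicity_index_stream_prefix_nonneg) simp
  have "0 < card {t. t < n \<and> ?us t = Insert i}"
    using i(1) assms(3) by (subst card_gt_0_iff) auto
  moreover have "{t. t < n \<and> ?us t = Delete i} = {}"
    by (auto simp: index_stream_def)
  ultimately have "0 < multiplicity_after ?us n i"
    by (simp only: multiplicity_after_def) simp
  then show ?thesis
    unfolding frequency_moment_def using i(2) nonneg
    by (intro sum_pos2[of _ i]) auto
qed

text \<open>Along even and along odd offsets the moment is constant, so ratios tending to 1 force
  the estimates themselves to converge to two constants. The unknown contribution of the rest of
  \<open>S\<close> cancels in their difference.\<close>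

lemma estimate_gap_index_stream:
  assumes "S \<subseteq> {..<m}" and "j < m" and "m < N" and "m \<le> n" and "k > 0"
    and "(\<lambda>t. estimate A (index_stream n m S j) \<omega> t
               / frequency_moment k N (index_stream n m S j) t) \<longlonglongrightarrow> 1"
  shows "(\<lambda>r. estimate A (index_stream n m S j) \<omega> (Suc (n + 2 * r))
             - estimate A (index_stream n m S j) \<omega> (n + 2 * r))
           \<longlonglongrightarrow> (if j \<in> S then 2 ^ k - 1 else 1)"
proof -
  let ?us = "index_stream n m S j"
  define C where "C = frequency_moment k N ?us n"
  define d :: real where "d = (if j \<in> S then 2 ^ k - 1 else 1)"
  have C: "C > 0"
    unfolding C_def using assms by (intro frequency_moment_index_stream_pos) auto
  have d: "d \<ge> 0"
    by (simp add: d_def)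
  have "(\<lambda>r. estimate A ?us \<omega> (n + 2 * r) / C) \<longlonglongrightarrow> 1"
    using LIMSEQ_subseq_LIMSEQ[OF assms(6), of "\<lambda>r. n + 2 * r"]
    by (simp add: o_def strict_mono_def frequency_moment_index_stream_even C_def)
  then have "(\<lambda>r. C * (estimate A ?us \<omega> (n + 2 * r) / C)) \<longlonglongrightarrow> C * 1"
    by (intro tendsto_intros)
  then have even: "(\<lambda>r. estimate A ?us \<omega> (n + 2 * r)) \<longlonglongrightarrow> C"
    using C by simp
  have "(\<lambda>r. estimate A ?us \<omega> (Suc (n + 2 * r)) / (C + d)) \<longlonglongrightarrow> 1"
    using LIMSEQ_subseq_LIMSEQ[OF assms(6), of "\<lambda>r. Suc (n + 2 * r)"]
      frequency_moment_index_stream_odd[OF assms(1-5)]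
    by (simp add: o_def strict_mono_def C_def d_def)
  then have "(\<lambda>r. (C + d) * (estimate A ?us \<omega> (Suc (n + 2 * r)) / (C + d))) \<longlonglongrightarrow> (C + d) * 1"
    by (intro tendsto_intros)
  then have "(\<lambda>r. estimate A ?us \<omega> (Suc (n + 2 * r))) \<longlonglongrightarrow> C + d"
    using C d by simp
  from tendsto_diff[OF this even] show ?thesis
    by (simp add: d_def)
qed

section \<open>The memory bound\<close>

text \<open>Equal memory and equal continuations give equal later estimates, hence the same limiting
  gap, and the gap reveals the bit.\<close>

lemma memory_determines_index:
  assumes "S \<subseteq> {..<m}" and "S' \<subseteq> {..<m}" and "j < m" and "m < N" and "m \<le> n" and "k \<ge> 2"
    and "\<And>T. T \<in> {S, S'} \<Longrightarrow>
           (\<lambda>t. estimate A (index_stream n m T j) \<omega> t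
                 / frequency_moment k N (index_stream n m T j) t) \<longlonglongrightarrow> 1"
    and "memory_after A (index_stream n m S j) \<omega> n = memory_after A (index_stream n m S' j) \<omega> n"
  shows "j \<in> S \<longleftrightarrow> j \<in> S'"
proof -
  have "estimate A (index_stream n m S j) \<omega> (n + r)
      = estimate A (index_stream n m S' j) \<omega> (n + r)" for r
    unfolding estimate_def using assms(8)
    by (subst memory_after_resume[where us' = "index_stream n m S' j"])
       (auto simp: index_stream_def)
  from this[of "2 * r" for r] this[of "Suc (2 * r)" for r]
  have eq: "(\<lambda>r. estimate A (index_stream n m S j) \<omega> (Suc (n + 2 * r))
             - estimate A (index_stream n m S j) \<omega> (n + 2 * r))
      = (\<lambda>r. estimate A (index_stream n m S' j) \<omega> (Suc (n + 2 * r))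
             - estimate A (index_stream n m S' j) \<omega> (n + 2 * r))"
    by simp
  have "k > 0"
    using assms(6) by simp
  note gap = estimate_gap_index_stream[OF _ assms(3,4,5) this assms(7)]
  have "(if j \<in> S then 2 ^ k - 1 else 1 :: real) = (if j \<in> S' then 2 ^ k - 1 else 1)"
    by (rule LIMSEQ_unique[OF gap[OF assms(1), unfolded eq] gap[OF assms(2)]]) auto
  \<comment> \<open>Thus \<open>2 ^ k - 1\<close> is at least 3 and the two possible gaps
    differ.\<close>
  moreover have "(2 :: real) ^ k \<ge> 2 ^ 2"
    using assms(6) by (intro power_increasing) auto
  ultimately show ?thesis
    by (auto split: if_splits)
qed

text \<open>For suitably fixed coins, the memory at time \<open>n\<close> encodes subsets of
  \<open>{..<m}\<close> as bit strings of length at most \<open>L\<close>, and the bound on random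
  access codes applies with \<open>p = 1 - \<delta>\<close>.\<close>

lemma asymptotically_exact_memory_bound:
  assumes k: "k \<ge> 2" and \<delta>: "\<delta> < 1 / 2" and exact: "asymptotically_exact k \<delta> N A"
    and m: "m < N" "m \<le> n" and L: "worst_case_memory N A n \<le> enat L"
  shows "(1 - 2 * \<delta>)\<^sup>2 * real m / 2 \<le> real L + 1"
proof -
  let ?us = "index_stream n m"
  let ?J = "{..<m}"
  define conv where "conv \<omega> S j \<longleftrightarrow> (\<lambda>t. estimate A (?us S j) \<omega> t
      / frequency_moment k N (?us S j) t) \<longlonglongrightarrow> 1" for \<omega> S j
  define E where "E = (\<lambda>(S, j). {\<omega> \<in> space (coins A). conv \<omega> S j})"
  interpret prob_space "coins A"
    using exact by (simp add: asymptotically_exact_def)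
  have E_prob: "1 - \<delta> \<le> prob (E i)" if i_mem: "i \<in> Pow ?J \<times> ?J" for i
  proof -
    obtain S j where i: "i = (S, j)" and S: "S \<subseteq> ?J" and j: "j < m"
      using i_mem by auto
    have us: "update_stream N (?us S j)"
      using S j m by (intro update_stream_index_stream) auto
    have "frequency_moment k N (?us S j) t > 0" if "t \<ge> n" for t
    proof -
      have "frequency_moment k N (?us S j) n > 0"
        using S j m by (intro frequency_moment_index_stream_pos) auto
      moreover have "(1 :: real) \<le> 2 ^ k"
        by simp
      ultimately show ?thesis
        using that frequency_moment_index_stream_odd[OF S j m] k
        by (cases rule: index_stream_time_cases[of t n])
           (auto simp: frequency_moment_index_stream_even add_pos_nonneg)
    qed
    then have "\<forall>\<^sub>F t in sequentially. frequency_moment k N (?us S j) t > 0"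
      by (auto simp: eventually_sequentially)
    then show ?thesis
      using exact us by (simp add: asymptotically_exact_def E_def conv_def i)
  qed
  \<comment> \<open>A non-measurable set would get measure 0, which is below
    \<open>1 - \<delta>\<close>.\<close>
  have E_event: "E i \<in> events" if "i \<in> Pow ?J \<times> ?J" for i
    using E_prob[OF that] \<delta> measure_notin_sets[of "E i" "coins A"] by force
  \<comment> \<open>One outcome now serves a fraction \<open>1 - \<delta>\<close> of all pairs of a
    set and a query.\<close>
  obtain \<omega> where \<omega>: "\<omega> \<in> space (coins A)"
    and good: "(1 - \<delta>) * real (card (Pow ?J \<times> ?J))
                 \<le> real (card {i \<in> Pow ?J \<times> ?J. \<omega> \<in> E i})"
    using average_event_count[of "Pow ?J \<times> ?J" E "1 - \<delta>"] E_prob E_event by auto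
  \<comment> \<open>The prefix does not depend on the query, so query 0 can stand for all of
    them.\<close>
  define enc where "enc S = memory_after A (?us S 0) \<omega> n" for S
  \<comment> \<open>Sets sharing a memory content cannot disagree about \<open>j\<close> if the
    estimates converge for both, so one convergent witness containing \<open>j\<close> settles the
    bit.\<close>
  define dec where "dec q = {j. \<exists>S\<subseteq>?J. enc S = q \<and> conv \<omega> S j \<and> j \<in> S}" for q
  have enc: "memory_after A (?us S j) \<omega> n = enc S" for S j
    unfolding enc_def by (rule memory_after_cong) (simp add: index_stream_def)
  have decode: "j \<in> S \<longleftrightarrow> j \<in> dec (enc S)" if "S \<subseteq> ?J" "j < m" "conv \<omega> S j" for S j
  proof
    assume "j \<in> dec (enc S)"
    then obtain S' where S': "S' \<subseteq> ?J" "enc S' = enc S" "conv \<omega> S' j" "j \<in> S'"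
      by (auto simp: dec_def)
    have "j \<in> S \<longleftrightarrow> j \<in> S'"
      by (rule memory_determines_index[OF that(1) S'(1) that(2) m k, where A = A and \<omega> = \<omega>])
         (use that S' enc in \<open>auto simp: conv_def\<close>)
    then show "j \<in> S"
      using S' by simp
  qed (use that in \<open>auto simp: dec_def\<close>)
  have "{i \<in> Pow ?J \<times> ?J. \<omega> \<in> E i} \<subseteq> (SIGMA S:Pow ?J. agreement ?J S (dec (enc S)))"
    using decode by (auto simp: E_def agreement_def)
  then have "card {i \<in> Pow ?J \<times> ?J. \<omega> \<in> E i}
      \<le> card (SIGMA S:Pow ?J. agreement ?J S (dec (enc S)))"
    by (intro card_mono finite_SigmaI) (auto simp: agreement_def)
  also have "\<dots> = (\<Sum>S\<in>Pow ?J. card (agreement ?J S (dec (enc S))))"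
    by (intro card_SigmaI) (auto simp: agreement_def)
  finally have "real (card {i \<in> Pow ?J \<times> ?J. \<omega> \<in> E i})
      \<le> (\<Sum>S\<in>Pow ?J. real (card (agreement ?J S (dec (enc S)))))"
    by (simp only: of_nat_le_iff flip: of_nat_sum)
  with good have correct: "(1 - \<delta>) * real (card ?J) * 2 ^ card ?J
      \<le> (\<Sum>S\<in>Pow ?J. real (card (agreement ?J S (dec (enc S)))))"
    by (simp add: card_cartesian_product card_Pow mult_ac)
  let ?Q = "{xs :: bool list. length xs \<le> L}"
  have fin_Q: "finite ?Q"
    using finite_lists_length_le[of "UNIV :: bool set" L] by simp
  have "length (enc S) \<le> L" if "S \<subseteq> ?J" for S
  proof -
    have "update_stream N (?us S 0)"
      using that m by (intro update_stream_index_stream) auto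
    then have "enat (length (enc S)) \<le> worst_case_memory N A n"
      unfolding worst_case_memory_def enc_def using \<omega>
      by (intro SUP_upper2[of "(?us S 0, \<omega>)"]) auto
    with L show ?thesis
      by (metis enat_ord_simps(1) order_trans)
  qed
  then have enc_Q: "enc ` Pow ?J \<subseteq> ?Q"
    by auto
  have "exp ((2 * (1 - \<delta>) - 1)\<^sup>2 * real (card ?J) / 2) \<le> real (card ?Q)"
    using \<delta> by (intro random_access_code_bound[OF _ fin_Q enc_Q _ correct]) auto
  also have "\<dots> \<le> real (2 ^ Suc L)"
    using card_bool_lists_length_le by (rule of_nat_mono)
  \<comment> \<open>Uses \<open>2 \<le> exp 1\<close>, an instance of
    \<open>1 + x \<le> exp x\<close>.\<close>
  also have "\<dots> \<le> exp 1 ^ Suc L"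
    unfolding of_nat_power using exp_ge_add_one_self[of 1] by (intro power_mono) auto
  also have "\<dots> = exp (real L + 1)"
    by (simp add: exp_add flip: exp_of_nat_mult)
  finally have "(2 * (1 - \<delta>) - 1)\<^sup>2 * real m / 2 \<le> real L + 1"
    by (simp only: exp_le_cancel_iff card_lessThan)
  moreover have "2 * (1 - \<delta>) - 1 = 1 - 2 * \<delta>"
    by simp
  ultimately show ?thesis
    by (simp only:)
qed

theorem theorem7:
  fixes k :: nat and \<delta> :: real and A :: "nat \<Rightarrow> 'w streaming_alg" and N :: "nat \<Rightarrow> nat"
  assumes "k \<ge> 2"
    and "\<delta> < 1 / 2"
    and "\<forall>M. asymptotically_exact k \<delta> M (A M)"
    and "(\<lambda>n. real (N n)) \<in> \<Omega>(\<lambda>n. real n)"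
  shows "\<exists>c>0. \<forall>\<^sub>F n in sequentially.
           ereal (c * real n) \<le> ereal_of_enat (worst_case_memory (N n) (A (N n)) n)"
proof -
  obtain b where b: "b > 0" "\<forall>\<^sub>F n in sequentially. b * real n \<le> real (N n)"
    using landau_omega.bigE[OF assms(4)] by auto
  \<comment> \<open>A fraction \<open>a\<close> of the \<open>n\<close> updates can carry data:
    \<open>m\<close> is limited by \<open>n\<close> and by \<open>N n - 1\<close>, and the latter is
    at least \<open>b / 2 * n\<close> once \<open>n \<ge> 2 / b\<close>.\<close>
  define a where "a = min 1 (b / 2)"
  \<comment> \<open>Half of the available constant: the bound reads
    \<open>2 * (c * n) \<le> L + 1\<close>, and \<open>c * n \<ge> 1\<close> for large
    \<open>n\<close> absorbs the additive 1.\<close>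
  define c where "c = (1 - 2 * \<delta>)\<^sup>2 * a / 4"
  have a: "a > 0"
    using b by (simp add: a_def)
  have c: "c > 0"
    using a assms(2) by (simp add: c_def)
  have "\<forall>\<^sub>F n in sequentially. 2 / b \<le> real n" "\<forall>\<^sub>F n in sequentially. 1 / c \<le> real n"
    by real_asymp+
  with b(2) have "\<forall>\<^sub>F n in sequentially.
      ereal (c * real n) \<le> ereal_of_enat (worst_case_memory (N n) (A (N n)) n)"
  proof eventually_elim
    case (elim n)
    show ?case
    proof (cases "worst_case_memory (N n) (A (N n)) n")
      case (enat L)
      define m where "m = min n (N n - 1)"
      have bn: "2 \<le> b * real n"
        using elim(2) b(1) by (simp add: field_simps)
      then have N: "N n \<ge> 2"
        using elim(1) by linarith
      have "real m \<ge> a * real n"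
      proof (cases "n \<le> N n - 1")
        case True
        have "a * real n \<le> 1 * real n"
          by (intro mult_right_mono) (auto simp: a_def)
        with True show ?thesis
          by (simp add: m_def)
      next
        case False
        have "a * real n \<le> b / 2 * real n"
          by (intro mult_right_mono) (auto simp: a_def)
        also have "\<dots> \<le> real (N n) - 1"
          using elim(1) bn by linarith
        finally show ?thesis
          using False N by (simp add: m_def of_nat_diff)
      qed
      then have "2 * (c * real n) \<le> (1 - 2 * \<delta>)\<^sup>2 * real m / 2"
        using mult_left_mono[of "a * real n" "real m" "(1 - 2 * \<delta>)\<^sup>2"]
        by (simp add: c_def mult_ac)
      also have "\<dots> \<le> real L + 1"
        using assms(1-3) N enat
        by (intro asymptotically_exact_memory_bound[where N = "N n" and A = "A (N n)" and n = n])
           (auto simp: m_def)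
      finally have "2 * (c * real n) \<le> real L + 1" .
      moreover have "1 \<le> c * real n"
        using elim(3) c by (simp add: field_simps)
      ultimately show ?thesis
        using enat by simp
    qed simp
  qed
  with c show ?thesis
    by blast
qed

end
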